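(* Let $k\ge 3$ be a fixed integer and let $S_k(x)=\sum_{n_1,\ldots,n_k\le x}\frac{1}{[n_1,\ldots,n_k]}$. Then $S_k(x)\asymp(\log x)^{2^k-1}$ as $x\to\infty$, i.e. there are constants $c_1,c_2>0$ (depending on $k$) with $c_1(\log x)^{2^k-1}\le S_k(x)\le c_2(\log x)^{2^k-1}$ for all sufficiently large $x$.
   Context: $[n_1,\ldots,n_k]$ denotes the least common multiple of the positive integers $n_1,\ldots,n_k$; the sum ranges over all $k$-tuples of positive integers $n_1,\ldots,n_k\le x$. *)

theory Defs
  imports Complex_Main "HOL-Library.FuncSet"
begin

text \<open>The \<open>k\<close>-tuples of positive integers \<open>\<le> x\<close> are the extensional functions on
  \<open>{1..k}\<close>, so each tuple is counted exactly once; there are finitely many of them for every real \<open>x\<close>.\<close>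

definition lcm_recip_sum :: "nat \<Rightarrow> real \<Rightarrow> real" where
  "lcm_recip_sum k x =
     (\<Sum>n \<in> {1..k} \<rightarrow>\<^sub>E {m::nat. 1 \<le> m \<and> real m \<le> x}. 1 / real (LCM i\<in>{1..k}. n i))"

end

theory Submission
  imports Defs "HOL-Analysis.Harmonic_Numbers" "HOL-Computational_Algebra.Primes"
begin

text \<open>Attach a positive integer \<open>d\<^sub>I\<close> to every nonempty set \<open>I\<close> of indices and put
  \<open>n\<^sub>i = \<Prod>\<^bsub>I \<ni> i\<^esub> d\<^sub>I\<close>. Every tuple \<open>n\<close> arises from a family \<open>d\<close> whose product is
  the least common multiple of \<open>n\<close>, so \<open>S\<^sub>k(x)\<close> is at most the \<open>(2\<^sup>k - 1)\<close>-th power of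
  \<open>\<Sum>\<^bsub>d \<le> x\<^esub> 1/d\<close>. Conversely, \<open>d \<mapsto> n\<close> is injective on pairwise coprime families, and
  the least common multiple always divides the product of the \<open>d\<^sub>I\<close>. If moreover all
  \<open>d\<^sub>I\<close> are coprime to \<open>K!\<close> for a large constant \<open>K\<close>, then two of them can only share primes
  \<open>p > K\<close>; as \<open>\<Sum>\<^bsub>p > K\<^esub> 1/p\<^sup>2\<close> is small, pairwise coprimality costs only a constant factor.\<close>

section \<open>Splitting a tuple into factors indexed by nonempty subsets\<close>

text \<open>The restriction to \<open>A\<close> makes the result extensional, so that it can equal a
  member of \<open>A \<rightarrow>\<^sub>E {1..N}\<close>. Only nonempty sets contain
  \<open>i\<close>, so families indexed by \<open>Pow A - {{}}\<close> suffice.\<close>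

definition subset_prod :: "'a set \<Rightarrow> ('a set \<Rightarrow> nat) \<Rightarrow> 'a \<Rightarrow> nat" where
  "subset_prod A d = (\<lambda>i\<in>A. \<Prod>I | I \<subseteq> A \<and> i \<in> I. d I)"

text \<open>Iterates the two-factor splitting \<open>dvd_productE\<close>. It serves to distribute a
  gcd over the factors of a least common multiple.\<close>

lemma dvd_prodE:
  fixes f :: "'a \<Rightarrow> nat"
  assumes "finite A" "m dvd (\<Prod>i\<in>A. f i)"
  obtains g where "m = (\<Prod>i\<in>A. g i)" "\<And>i. i \<in> A \<Longrightarrow> g i dvd f i"
  using assms
proof (induction A arbitrary: m thesis rule: finite_induct)
  case empty
  then show ?case by simp
next
  case (insert a A)
  from insert.prems(2) insert.hyps have "m dvd f a * (\<Prod>i\<in>A. f i)" by simp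
  then obtain x y where xy: "m = x * y" "x dvd f a" "y dvd (\<Prod>i\<in>A. f i)"
    by (rule dvd_productE)
  obtain g where g: "y = (\<Prod>i\<in>A. g i)" "\<And>i. i \<in> A \<Longrightarrow> g i dvd f i"
    using insert.IH[OF _ xy(3)] by blast
  show ?case
  proof (rule insert.prems(1)[of "g(a := x)"])
    have "(\<Prod>i\<in>A. (g(a := x)) i) = (\<Prod>i\<in>A. g i)"
      using insert.hyps by (intro prod.cong) auto
    then show "m = (\<Prod>i\<in>insert a A. (g(a := x)) i)"
      using insert.hyps xy g by simp
  qed (use xy g in auto)
qed

text \<open>Induction on \<open>A\<close>. When an index \<open>a\<close> is added, each old
  \<open>d I\<close> splits into a factor shared with \<open>n a\<close> and a remainder. Products
  through old indices stay the same, while the total product grows by exactly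
  \<open>n a div gcd L (n a)\<close>, where \<open>L\<close> is the old least common
  multiple.\<close>

lemma lcm_factorization:
  fixes n :: "'a \<Rightarrow> nat"
  assumes "finite A" "\<And>i. i \<in> A \<Longrightarrow> n i > 0"
  shows "\<exists>d. (\<forall>i\<in>A. n i = (\<Prod>I | I \<subseteq> A \<and> i \<in> I. d I)) \<and>
             (LCM i\<in>A. n i) = (\<Prod>I\<in>Pow A - {{}}. d I)"
  using assms
proof (induction A rule: finite_induct)
  case empty
  then show ?case by simp
next
  case (insert a A)
  define P where "P = Pow A - {{}}"
  have [simp]: "finite P" using insert.hyps by (simp add: P_def)
  obtain d where d: "\<And>i. i \<in> A \<Longrightarrow> n i = (\<Prod>I | I \<subseteq> A \<and> i \<in> I. d I)"
    and L: "(LCM i\<in>A. n i) = (\<Prod>I\<in>P. d I)"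
    using insert unfolding P_def by auto
  define m L where "m = n a" and "L = (LCM i\<in>A. n i)"
  have "m > 0" using insert.prems by (simp add: m_def)
  have "gcd L m dvd (\<Prod>I\<in>P. d I)" unfolding L[symmetric] L_def by simp
  then obtain g where g: "gcd L m = (\<Prod>I\<in>P. g I)" "\<And>I. I \<in> P \<Longrightarrow> g I dvd d I"
    by (rule dvd_prodE[rotated]) auto
  \<comment> \<open>The part \<open>g I\<close> of \<open>d I\<close> shared with \<open>n a\<close> moves to \<open>insert a I\<close>;
    what remains of \<open>n a\<close> goes to \<open>{a}\<close>.\<close>
  define h where "h I = (if I = {} then m div gcd L m else g I)" for I
  define e where "e I = (if a \<in> I then h (I - {a}) else d I div g I)" for I
  have [simp]: "finite A" "a \<notin> A" using insert.hyps by auto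
  have inj: "inj_on (insert a) X" if "X \<subseteq> Pow A" for X
    using that insert.hyps(2)
    by (intro inj_onI) (metis Pow_iff insert_ident subsetD)
  have ins: "(\<Prod>I\<in>insert a ` X. e I) = (\<Prod>I\<in>X. h I)" if "X \<subseteq> Pow A" for X
  proof -
    have "(\<Prod>I\<in>insert a ` X. e I) = (\<Prod>I\<in>X. e (insert a I))"
      using prod.reindex[OF inj[OF that], of e] by simp
    also have "\<dots> = (\<Prod>I\<in>X. h I)"
    proof (rule prod.cong)
      fix I assume "I \<in> X"
      then have "a \<notin> I" using that \<open>a \<notin> A\<close> by blast
      then show "e (insert a I) = h I" by (simp add: e_def)
    qed simp
    finally show ?thesis .
  qed
  have PowA: "Pow A = insert {} P" by (auto simp: P_def)
  have hall: "(\<Prod>I\<in>Pow A. h I) = m"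
  proof -
    have "(\<Prod>I\<in>P. h I) = gcd L m"
      unfolding g by (intro prod.cong) (auto simp: h_def P_def)
    moreover have "(\<Prod>I\<in>Pow A. h I) = h {} * (\<Prod>I\<in>P. h I)"
      unfolding PowA by (subst prod.insert) (auto simp: P_def)
    ultimately show ?thesis by (simp add: h_def)
  qed
  have na: "n a = (\<Prod>I | I \<subseteq> insert a A \<and> a \<in> I. e I)"
  proof -
    have "{I. I \<subseteq> insert a A \<and> a \<in> I} = insert a ` Pow A"
    proof (intro equalityI subsetI)
      fix I assume "I \<in> {I. I \<subseteq> insert a A \<and> a \<in> I}"
      then have "I = insert a (I - {a})" "I - {a} \<in> Pow A" by auto
      then show "I \<in> insert a ` Pow A" by blast
    qed auto
    then show ?thesis using ins[of "Pow A"] hall by (simp add: m_def)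
  qed
  \<comment> \<open>The sets through an old index pair up as \<open>I\<close> and
    \<open>insert a I\<close>, and their values multiply to
    \<open>(d I div g I) * g I = d I\<close>.\<close>
  have ni: "n i = (\<Prod>I | I \<subseteq> insert a A \<and> i \<in> I. e I)" if "i \<in> A" for i
  proof -
    define X where "X = {I. I \<subseteq> A \<and> i \<in> I}"
    have XP: "X \<subseteq> P" "X \<subseteq> Pow A" by (auto simp: X_def P_def)
    have [simp]: "finite X" using XP(1) by (rule finite_subset) simp
    have "i \<noteq> a" using that insert.hyps(2) by auto
    have eq: "{I. I \<subseteq> insert a A \<and> i \<in> I} = X \<union> insert a ` X"
    proof (intro equalityI subsetI)
      fix I assume I: "I \<in> {I. I \<subseteq> insert a A \<and> i \<in> I}"
      show "I \<in> X \<union> insert a ` X"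
      proof (cases "a \<in> I")
        case True
        then have "I = insert a (I - {a})" "I - {a} \<in> X"
          using I \<open>i \<noteq> a\<close> by (auto simp: X_def)
        then show ?thesis by blast
      qed (use I in \<open>auto simp: X_def\<close>)
    qed (auto simp: X_def)
    have disj: "X \<inter> insert a ` X = {}" using insert.hyps(2) XP by auto
    have "(\<Prod>I | I \<subseteq> insert a A \<and> i \<in> I. e I) = (\<Prod>I\<in>X. e I) * (\<Prod>I\<in>X. h I)"
      unfolding eq using prod.union_disjoint[OF _ _ disj, of e] ins[OF XP(2)] by simp
    also have "\<dots> = (\<Prod>I\<in>X. e I * h I)" by (simp add: prod.distrib)
    also have "\<dots> = (\<Prod>I\<in>X. d I)"
    proof (rule prod.cong)
      fix I assume "I \<in> X"
      with XP \<open>a \<notin> A\<close> have "I \<in> P" "a \<notin> I" by blast+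
      then have "I \<noteq> {}" by (simp add: P_def)
      then show "e I * h I = d I" using g(2) \<open>I \<in> P\<close> \<open>a \<notin> I\<close> by (simp add: e_def h_def)
    qed simp
    finally show ?thesis using d[OF that] by (simp add: X_def)
  qed
  have lcm: "(LCM i\<in>insert a A. n i) = (\<Prod>I\<in>Pow (insert a A) - {{}}. e I)"
  proof -
    have eq: "Pow (insert a A) - {{}} = P \<union> insert a ` Pow A"
      by (auto simp: Pow_insert P_def)
    have disj: "P \<inter> insert a ` Pow A = {}" using insert.hyps(2) by (auto simp: P_def)
    have "(\<Prod>I\<in>Pow (insert a A) - {{}}. e I) = (\<Prod>I\<in>P. e I) * m"
      unfolding eq using prod.union_disjoint[OF _ _ disj, of e] ins[of "Pow A"] hall by simp
    \<comment> \<open>Both sides of the claim are compared after multiplication by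
      \<open>gcd L m\<close>, which is cancelled at the end because \<open>m > 0\<close>.\<close>
    moreover have "(\<Prod>I\<in>P. e I) * gcd L m = L"
    proof -
      have "(\<Prod>I\<in>P. e I) * gcd L m = (\<Prod>I\<in>P. e I * g I)"
        unfolding g by (simp add: prod.distrib)
      also have "\<dots> = (\<Prod>I\<in>P. d I)"
      proof (rule prod.cong)
        fix I assume "I \<in> P"
        then have "a \<notin> I" using insert.hyps(2) by (auto simp: P_def)
        then show "e I * g I = d I" using g(2)[OF \<open>I \<in> P\<close>] by (simp add: e_def)
      qed simp
      finally show ?thesis using L by (simp add: L_def)
    qed
    moreover have "(LCM i\<in>insert a A. n i) * gcd L m = L * m"
      using prod_gcd_lcm_nat[of L m] by (simp add: L_def m_def lcm.commute mult.commute)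
    ultimately have "(LCM i\<in>insert a A. n i) * gcd L m = (\<Prod>I\<in>Pow (insert a A) - {{}}. e I) * gcd L m"
      by (metis mult.commute mult.left_commute)
    then show ?thesis using \<open>m > 0\<close> by simp
  qed
  show ?case using na ni lcm by (intro exI[of _ e]) auto
qed

section \<open>Upper bound by a power of the harmonic sum\<close>

lemma lcm_recip_sum_upper:
  assumes "finite A"
  shows "(\<Sum>n\<in>A \<rightarrow>\<^sub>E {1..N}. 1 / real (LCM i\<in>A. n i)) \<le> harm N ^ (2 ^ card A - 1)"
proof -
  define P where "P = Pow A - {{}}"
  have [simp]: "finite P" and cP: "card P = 2 ^ card A - 1"
    using assms by (simp_all add: P_def card_Pow)
  have "(\<Sum>n\<in>A \<rightarrow>\<^sub>E {1..N}. 1 / real (LCM i\<in>A. n i)) \<le> (\<Sum>d\<in>P \<rightarrow>\<^sub>E {1..N}. \<Prod>I\<in>P. inverse (real (d I)))"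
  \<comment> \<open>Each tuple needs just one preimage of the right weight; all further families
    only enlarge the right-hand side. The enlarged sum runs over a full product set and therefore
    factors.\<close>
  proof (rule sum_le_included[where i = "subset_prod A"])
    show "\<forall>n\<in>A \<rightarrow>\<^sub>E {1..N}. \<exists>d\<in>P \<rightarrow>\<^sub>E {1..N}. subset_prod A d = n \<and>
      1 / real (LCM i\<in>A. n i) \<le> (\<Prod>I\<in>P. inverse (real (d I)))"
    proof
      fix n assume n: "n \<in> A \<rightarrow>\<^sub>E {1..N}"
      have npos: "n i > 0" if "i \<in> A" for i using n that by (force dest: PiE_mem)
      obtain d where d: "\<And>i. i \<in> A \<Longrightarrow> n i = (\<Prod>I | I \<subseteq> A \<and> i \<in> I. d I)"
        and L: "(LCM i\<in>A. n i) = (\<Prod>I\<in>P. d I)"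
        using lcm_factorization[of A n] assms npos unfolding P_def by auto
      have "subset_prod A (restrict d P) = n"
      proof
        fix i
        show "subset_prod A (restrict d P) i = n i"
        proof (cases "i \<in> A")
          case True
          have "(\<Prod>I | I \<subseteq> A \<and> i \<in> I. restrict d P I) = (\<Prod>I | I \<subseteq> A \<and> i \<in> I. d I)"
            by (intro prod.cong) (auto simp: P_def)
          with True d show ?thesis by (simp add: subset_prod_def)
        next
          case False
          with n show ?thesis by (auto simp: subset_prod_def PiE_def extensional_def)
        qed
      qed
      moreover have "restrict d P \<in> P \<rightarrow>\<^sub>E {1..N}"
      proof (rule restrict_PiE_iff[THEN iffD2, rule_format])
        fix I assume I: "I \<in> P"
        then obtain i where i: "i \<in> I" "i \<in> A" by (auto simp: P_def)
        have "d I dvd (\<Prod>I | I \<subseteq> A \<and> i \<in> I. d I)"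
          using assms I i by (intro dvd_prodI) (auto simp: P_def)
        then have "d I dvd n i" using d i by simp
        moreover have "n i \<in> {1..N}" using n i by auto
        ultimately show "d I \<in> {1..N}"
          by (auto dest: dvd_imp_le intro!: Suc_leI Nat.gr0I)
      qed
      moreover have "1 / real (LCM i\<in>A. n i) = (\<Prod>I\<in>P. inverse (real (restrict d P I)))"
        unfolding L by (simp add: prod_inversef[symmetric] divide_inverse o_def)
      ultimately show "\<exists>d\<in>P \<rightarrow>\<^sub>E {1..N}. subset_prod A d = n \<and>
        1 / real (LCM i\<in>A. n i) \<le> (\<Prod>I\<in>P. inverse (real (d I)))" by (metis order_refl)
    qed
  qed (auto intro!: finite_PiE assms prod_nonneg)
  also have "\<dots> = (\<Prod>I\<in>P. \<Sum>m\<in>{1..N}. inverse (real m))"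
    by (rule prod_sum_PiE[symmetric]) auto
  also have "\<dots> = harm N ^ (2 ^ card A - 1)" by (simp add: cP harm_def)
  finally show ?thesis .
qed

section \<open>Recovering a pairwise coprime family from its tuple\<close>

text \<open>A prime divides at most one member of a coprime family, so the tuple alone reveals the
  set \<open>I\<close> at which the prime sits.\<close>

lemma subset_prod_common_prime:
  assumes "finite A" "p dvd d I" "I \<subseteq> A" "I \<noteq> {}" "prime p"
    and cop: "pairwise (\<lambda>I J. coprime (d I) (d J)) (Pow A - {{}})"
  shows "{i\<in>A. p dvd subset_prod A d i} = I"
proof (intro equalityI subsetI)
  fix i assume i: "i \<in> {i\<in>A. p dvd subset_prod A d i}"
  then have "p dvd (\<Prod>I | I \<subseteq> A \<and> i \<in> I. d I)" by (auto simp: subset_prod_def)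
  then obtain J where J: "J \<subseteq> A" "i \<in> J" "p dvd d J"
    using \<open>prime p\<close> assms(1) by (subst (asm) prime_dvd_prod_iff) auto
  show "i \<in> I"
  proof (rule ccontr)
    assume "i \<notin> I"
    then have "coprime (d I) (d J)"
      using pairwiseD[OF cop, of I J] J assms by auto
    with J assms show False using not_prime_unit coprime_common_divisor by blast
  qed
next
  fix i assume "i \<in> I"
  then have "d I dvd (\<Prod>I | I \<subseteq> A \<and> i \<in> I. d I)"
    using assms by (intro dvd_prodI) auto
  with \<open>p dvd d I\<close> \<open>i \<in> I\<close> \<open>I \<subseteq> A\<close> show "i \<in> {i\<in>A. p dvd subset_prod A d i}"
    by (auto simp: subset_prod_def intro: dvd_trans)
qed

text \<open>A prime dividing both \<open>d I\<close> and \<open>e J\<close> locates the same index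
  set in both families, forcing \<open>I = J\<close>. So \<open>d I\<close> is coprime to every
  other \<open>e J\<close> in the product that gives the entry at some \<open>i \<in> I\<close>; as
  it divides that product, it divides \<open>e I\<close>.\<close>

lemma subset_prod_dvd:
  assumes "finite A" "subset_prod A d = subset_prod A e" "I \<subseteq> A" "I \<noteq> {}"
    and "pairwise (\<lambda>I J. coprime (d I) (d J)) (Pow A - {{}})"
    and "pairwise (\<lambda>I J. coprime (e I) (e J)) (Pow A - {{}})"
  shows "d I dvd e I"
proof -
  obtain i where i: "i \<in> I" "i \<in> A" using assms by auto
  define X where "X = {I. I \<subseteq> A \<and> i \<in> I}"
  have X: "finite X" "I \<in> X" using assms i by (auto simp: X_def)
  have "d I dvd (\<Prod>I\<in>X. d I)" using X by (intro dvd_prodI) auto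
  also have "\<dots> = (\<Prod>I\<in>X. e I)"
    using fun_cong[OF assms(2), of i] i by (simp add: subset_prod_def X_def)
  also have "\<dots> = e I * (\<Prod>I\<in>X - {I}. e I)" using X by (rule prod.remove)
  finally have "d I dvd e I * (\<Prod>I\<in>X - {I}. e I)" .
  moreover have "coprime (d I) (\<Prod>I\<in>X - {I}. e I)"
  proof (rule prod_coprime_right, rule ccontr)
    fix J assume J: "J \<in> X - {I}" and "\<not> coprime (d I) (e J)"
    then obtain p where p: "prime p" "p dvd d I" "p dvd e J"
      using prime_factor_nat[of "gcd (d I) (e J)"] by (auto simp: coprime_iff_gcd_eq_1)
    have "I = J"
      using subset_prod_common_prime[of A p d I] subset_prod_common_prime[of A p e J] p J assms
      by (auto simp: X_def)
    with J show False by auto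
  qed
  ultimately show ?thesis by (simp add: coprime_dvd_mult_left_iff)
qed

lemma inj_on_subset_prod:
  assumes "finite A"
  shows "inj_on (subset_prod A)
    {d \<in> (Pow A - {{}}) \<rightarrow>\<^sub>E B. pairwise (\<lambda>I J. coprime (d I) (d J)) (Pow A - {{}})}"
proof (rule inj_onI)
  fix d e
  assume "d \<in> {d \<in> (Pow A - {{}}) \<rightarrow>\<^sub>E B. pairwise (\<lambda>I J. coprime (d I) (d J)) (Pow A - {{}})}"
    "e \<in> {d \<in> (Pow A - {{}}) \<rightarrow>\<^sub>E B. pairwise (\<lambda>I J. coprime (d I) (d J)) (Pow A - {{}})}"
    and eq: "subset_prod A d = subset_prod A e"
  then have d: "d \<in> (Pow A - {{}}) \<rightarrow>\<^sub>E B" "pairwise (\<lambda>I J. coprime (d I) (d J)) (Pow A - {{}})"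
    and e: "e \<in> (Pow A - {{}}) \<rightarrow>\<^sub>E B" "pairwise (\<lambda>I J. coprime (e I) (e J)) (Pow A - {{}})"
    by auto
  show "d = e"
  proof (rule PiE_ext[OF d(1) e(1)])
    fix I assume "I \<in> Pow A - {{}}"
    then show "d I = e I"
      using subset_prod_dvd[OF assms eq _ _ d(2) e(2)] subset_prod_dvd[OF assms eq[symmetric] _ _ e(2) d(2)]
      by (auto intro: dvd_antisym)
  qed
qed

section \<open>The cost of pairwise coprimality\<close>

text \<open>Telescoping from \<open>1 / m ^ 2 \<le> 1 / (m - 1) - 1 / m\<close>.\<close>

lemma sum_inverse_squares_le:
  assumes "finite F" "\<And>m. m \<in> F \<Longrightarrow> m > K" "K > 0"
  shows "(\<Sum>m\<in>F. 1 / real m ^ 2) \<le> 1 / real K"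
proof -
  have "(\<Sum>m\<in>{K<..K+t}. 1 / real m ^ 2) \<le> 1 / real K - 1 / real (K + t)" for t
  proof (induction t)
    case (Suc t)
    have "{K<..K + Suc t} = insert (K + Suc t) {K<..K+t}" by auto
    then have "(\<Sum>m\<in>{K<..K+Suc t}. 1 / real m ^ 2)
        = 1 / real (K + Suc t) ^ 2 + (\<Sum>m\<in>{K<..K+t}. 1 / real m ^ 2)" by simp
    also have "\<dots> \<le> 1 / real (K + Suc t) ^ 2 + (1 / real K - 1 / real (K + t))"
      using Suc by simp
    also have "1 / real (K + Suc t) ^ 2 \<le> 1 / real (K + t) - 1 / real (K + Suc t)"
    proof -
      define y where "y = real (K + t)"
      have "y > 0" using \<open>K > 0\<close> by (simp add: y_def)
      then have "1 / (y + 1) ^ 2 \<le> 1 / y - 1 / (y + 1)"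
        by (simp add: divide_simps power2_eq_square)
      then show ?thesis by (simp add: y_def add_ac)
    qed
    finally show ?case by simp
  qed simp
  then have bound: "(\<Sum>m\<in>{K<..K+t}. 1 / real m ^ 2) \<le> 1 / real K" for t
    by (rule order_trans) simp
  have "(\<Sum>m\<in>F. 1 / real m ^ 2) \<le> (\<Sum>m\<in>{K<..K+Max F}. 1 / real m ^ 2)"
    using assms by (intro sum_mono2) (auto intro!: trans_le_add2)
  with bound[of "Max F"] show ?thesis by linarith
qed

text \<open>Dividing a multiple of \<open>p\<close> by \<open>p\<close> stays inside the
  divisor-closed set \<open>D\<close> and pulls out the factor \<open>1 / p\<close>.\<close>

lemma sum_inverse_multiples_le:
  fixes D :: "nat set"
  assumes "finite D" "\<And>m n. m dvd n \<Longrightarrow> n \<in> D \<Longrightarrow> m \<in> D" "p > 0"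
  shows "(\<Sum>m | m \<in> D \<and> p dvd m. inverse (real m)) \<le> (\<Sum>m\<in>D. inverse (real m)) / real p"
proof -
  have "(\<Sum>m | m \<in> D \<and> p dvd m. inverse (real m)) \<le> (\<Sum>m\<in>D. inverse (real m) / real p)"
  proof (rule sum_le_included[where i = "\<lambda>m. p * m"])
    show "\<forall>m\<in>{m \<in> D. p dvd m}. \<exists>n\<in>D. p * n = m \<and> inverse (real m) \<le> inverse (real n) / real p"
    proof
      fix m assume "m \<in> {m \<in> D. p dvd m}"
      then have m: "m \<in> D" "m = p * (m div p)" by auto
      then have "m div p \<in> D" using assms(2)[of "m div p" m] by (metis dvd_triv_right)
      moreover have "inverse (real m) = inverse (real (m div p)) / real p"
        by (subst m(2)) (simp add: divide_inverse)
      ultimately show "\<exists>n\<in>D. p * n = m \<and> inverse (real m) \<le> inverse (real n) / real p"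
        using m(2) by (intro bexI[of _ "m div p"]) auto
    qed
  qed (use assms in auto)
  then show ?thesis by (simp add: sum_divide_distrib)
qed

text \<open>Union bound: a family that is not coprime has two members sharing a prime
  \<open>p \<in> D\<close>. For a fixed pair and prime such families carry at most a
  \<open>1 / p ^ 2\<close> share of the full sum. There are at most \<open>card P ^ 2\<close> pairs
  and every prime is large, so the bad families carry at most half.\<close>

lemma sum_pairwise_coprime_ge:
  fixes D :: "nat set" and P :: "'a set"
  assumes "finite D" "finite P" "P \<noteq> {}"
    and dvd: "\<And>m n. m dvd n \<Longrightarrow> n \<in> D \<Longrightarrow> m \<in> D"
    and large: "\<And>p. prime p \<Longrightarrow> p \<in> D \<Longrightarrow> p > 2 * card P ^ 2"
  shows "(\<Sum>d | d \<in> P \<rightarrow>\<^sub>E D \<and> pairwise (\<lambda>i j. coprime (d i) (d j)) P. \<Prod>i\<in>P. inverse (real (d i)))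
    \<ge> (\<Sum>m\<in>D. inverse (real m)) ^ card P / 2"
proof -
  define M where "M = card P"
  have "M > 0" using assms by (simp add: M_def card_gt_0_iff)
  define S where "S = (\<Sum>m\<in>D. inverse (real m))"
  have "S \<ge> 0" unfolding S_def by (intro sum_nonneg) auto
  define w where "w d = (\<Prod>i\<in>P. inverse (real (d i)))" for d :: "'a \<Rightarrow> nat"
  have w_nonneg: "w d \<ge> 0" for d by (auto simp: w_def intro!: prod_nonneg)
  define G where "G = {d \<in> P \<rightarrow>\<^sub>E D. pairwise (\<lambda>i j. coprime (d i) (d j)) P}"
  define B where "B = (P \<rightarrow>\<^sub>E D) - G"
  have fin: "finite (P \<rightarrow>\<^sub>E D)" using assms by (intro finite_PiE) auto
  define F where "F = {p \<in> D. prime p}"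
  define R where "R = {ij \<in> P \<times> P. fst ij \<noteq> snd ij} \<times> F"
  have fR: "finite R" "finite F" using assms by (auto simp: R_def F_def)
  define C where "C = (\<lambda>((i,j),p). {d \<in> P \<rightarrow>\<^sub>E D. p dvd d i \<and> p dvd d j})"
  have C: "(\<Sum>d\<in>C ((i,j),p). w d) \<le> S ^ M * (1 / real p ^ 2)"
    if "i \<in> P" "j \<in> P" "i \<noteq> j" "p \<in> F" for i j p
  proof -
    have "p > 0" using that by (auto simp: F_def prime_gt_0_nat)
    \<comment> \<open>Divisibility by \<open>p\<close> constrains the coordinates \<open>i\<close>
      and \<open>j\<close> separately, so the set is again a product and its sum factors, with a
      gain of \<open>1 / p\<close> at each of the two.\<close>
    define E where "E l = (if l = i \<or> l = j then {m \<in> D. p dvd m} else D)" for l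
    have "C ((i,j),p) = PiE P E"
    proof (rule set_eqI)
      fix d
      have "d \<in> PiE P E \<longleftrightarrow> d \<in> extensional P \<and> (\<forall>l\<in>P. d l \<in> D) \<and> p dvd d i \<and> p dvd d j"
        using that unfolding PiE_iff E_def by auto
      then show "d \<in> C ((i,j),p) \<longleftrightarrow> d \<in> PiE P E" by (simp add: C_def PiE_iff conj_ac)
    qed
    then have "(\<Sum>d\<in>C ((i,j),p). w d) = (\<Prod>l\<in>P. \<Sum>m\<in>E l. inverse (real m))"
      unfolding w_def using assms by (subst prod_sum_PiE) (auto simp: E_def)
    also have "\<dots> \<le> (\<Prod>l\<in>P. S * (if l = i then 1 / p else 1) * (if l = j then 1 / p else 1))"
    proof (rule prod_mono, rule conjI)
      fix l
      show "(\<Sum>m\<in>E l. inverse (real m)) \<le> S * (if l = i then 1 / p else 1) * (if l = j then 1 / p else 1)"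
        using sum_inverse_multiples_le[OF assms(1) dvd \<open>p > 0\<close>] \<open>i \<noteq> j\<close>
        by (auto simp: E_def S_def)
    qed (auto intro!: sum_nonneg)
    also have "\<dots> = S ^ M * (1 / real p ^ 2)"
      using that assms by (simp add: prod.distrib M_def power2_eq_square)
    finally show ?thesis .
  qed
  \<comment> \<open>A bad family may have several witnesses \<open>((i,j),p)\<close>; the sum over
    the disjoint union counts it once for each.\<close>
  have "(\<Sum>d\<in>B. w d) \<le> (\<Sum>td\<in>(SIGMA t:R. C t). w (snd td))"
  proof (rule sum_le_included[where i = snd])
    show "finite (SIGMA t:R. C t)"
      using fR fin by (intro finite_SigmaI) (auto simp: C_def)
    show "\<forall>d\<in>B. \<exists>td\<in>(SIGMA t:R. C t). snd td = d \<and> w d \<le> w (snd td)"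
    proof
      fix d assume "d \<in> B"
      then have d: "d \<in> P \<rightarrow>\<^sub>E D" "\<not> pairwise (\<lambda>i j. coprime (d i) (d j)) P"
        by (auto simp: B_def G_def)
      then obtain i j where ij: "i \<in> P" "j \<in> P" "i \<noteq> j" "\<not> coprime (d i) (d j)"
        by (auto simp: pairwise_def)
      then obtain p where p: "prime p" "p dvd d i" "p dvd d j"
        using prime_factor_nat[of "gcd (d i) (d j)"] by (auto simp: coprime_iff_gcd_eq_1)
      have "p \<in> F" using p ij d dvd[of p "d i"] by (auto simp: F_def)
      then have "(((i,j),p), d) \<in> (SIGMA t:R. C t)" using p ij d by (auto simp: R_def C_def)
      then show "\<exists>td\<in>(SIGMA t:R. C t). snd td = d \<and> w d \<le> w (snd td)" by force
    qed
  qed (use fin w_nonneg in \<open>auto simp: B_def\<close>)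
  also have "\<dots> = (\<Sum>t\<in>R. \<Sum>d\<in>C t. w d)"
    using fR fin by (subst sum.Sigma) (auto simp: C_def case_prod_unfold)
  also have "\<dots> \<le> (\<Sum>t\<in>R. S ^ M * (1 / real (snd t) ^ 2))"
    by (rule sum_mono) (use C in \<open>auto simp: R_def\<close>)
  also have "\<dots> = S ^ M * (real (card {ij \<in> P \<times> P. fst ij \<noteq> snd ij}) * (\<Sum>p\<in>F. 1 / real p ^ 2))"
    unfolding R_def by (subst sum.cartesian_product[symmetric, where g = "\<lambda>_ p. S ^ M * (1 / real p ^ 2)", unfolded case_prod_unfold])
      (simp add: sum_distrib_left mult_ac)
  \<comment> \<open>All primes in \<open>F\<close> exceed \<open>2 * M ^ 2\<close>, so the tail of
    inverse squares offsets the number of pairs up to a factor 1/2.\<close>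
  also have "\<dots> \<le> S ^ M * (real (M ^ 2) * (1 / real (2 * M ^ 2)))"
  proof (intro mult_left_mono mult_mono)
    have "card {ij \<in> P \<times> P. fst ij \<noteq> snd ij} \<le> card (P \<times> P)"
      using assms by (intro card_mono) auto
    then show "real (card {ij \<in> P \<times> P. fst ij \<noteq> snd ij}) \<le> real (M ^ 2)"
      by (simp only: of_nat_le_iff card_cartesian_product M_def power2_eq_square)
    show "(\<Sum>p\<in>F. 1 / real p ^ 2) \<le> 1 / real (2 * M ^ 2)"
      using fR large \<open>M > 0\<close> by (intro sum_inverse_squares_le) (auto simp: F_def M_def)
  qed (use \<open>S \<ge> 0\<close> in \<open>auto intro!: sum_nonneg\<close>)
  also have "\<dots> = S ^ M / 2" using \<open>M > 0\<close> by simp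
  finally have "(\<Sum>d\<in>B. w d) \<le> S ^ M / 2" .
  moreover have "(\<Sum>d\<in>P \<rightarrow>\<^sub>E D. w d) = S ^ M"
    unfolding w_def S_def M_def using prod_sum_PiE[of P "\<lambda>_. D" "\<lambda>_ m. inverse (real m)"] assms by simp
  moreover have "(\<Sum>d\<in>P \<rightarrow>\<^sub>E D. w d) = (\<Sum>d\<in>B. w d) + (\<Sum>d\<in>G. w d)"
    unfolding B_def by (rule sum.subset_diff) (use fin in \<open>auto simp: G_def\<close>)
  ultimately show ?thesis unfolding G_def w_def S_def M_def by simp
qed

section \<open>Lower bound from integers coprime to a factorial\<close>

text \<open>It is enough to keep the progression \<open>1 + W * t\<close> with
  \<open>t < Y div W\<close>: its terms are coprime to \<open>W\<close> and at most
  \<open>W * (t + 1)\<close>, which leaves a harmonic sum divided by \<open>W\<close>.\<close>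

lemma sum_inverse_coprime_ge:
  assumes "W > 0"
  shows "(\<Sum>m | 1 \<le> m \<and> m \<le> Y \<and> coprime m W. inverse (real m)) \<ge> ln (real (Y + 1) / real W) / real W"
proof -
  define T where "T = Y div W"
  define f where "f t = 1 + W * t" for t
  have "Y + 1 \<le> W * (T + 1)"
    using dividend_less_times_div[OF assms, of Y] by (simp add: T_def)
  then have "real (Y + 1) \<le> real W * real (T + 1)" by (metis of_nat_le_iff of_nat_mult)
  then have "ln (real (Y + 1) / real W) \<le> ln (real T + 1)"
    using assms by (subst ln_le_cancel_iff) (auto simp: field_simps)
  also have "\<dots> \<le> harm T" by (rule ln_le_harm)
  finally have "ln (real (Y + 1) / real W) / real W \<le> harm T / real W"
    by (rule divide_right_mono) simp
  also have "\<dots> = (\<Sum>t<T. inverse (real (Suc t)) / real W)"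
    by (simp add: harm_altdef sum_divide_distrib)
  also have "\<dots> \<le> (\<Sum>t<T. inverse (real (f t)))"
  proof (rule sum_mono)
    fix t
    have "f t \<le> W * Suc t" using assms by (simp add: f_def)
    then have "real (f t) \<le> real W * real (Suc t)" by (metis of_nat_le_iff of_nat_mult)
    then have "inverse (real W * real (Suc t)) \<le> inverse (real (f t))"
      by (intro le_imp_inverse_le) (simp_all add: f_def add_pos_nonneg)
    then show "inverse (real (Suc t)) / real W \<le> inverse (real (f t))"
      by (simp add: divide_inverse mult_ac)
  qed
  also have "\<dots> = (\<Sum>m\<in>f ` {..<T}. inverse (real m))"
    using assms by (subst sum.reindex) (auto simp: inj_on_def f_def)
  also have "\<dots> \<le> (\<Sum>m | 1 \<le> m \<and> m \<le> Y \<and> coprime m W. inverse (real m))"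
  proof (rule sum_mono2)
    show "finite {m. 1 \<le> m \<and> m \<le> Y \<and> coprime m W}"
      by (rule finite_subset[of _ "{..Y}"]) auto
    show "f ` {..<T} \<subseteq> {m. 1 \<le> m \<and> m \<le> Y \<and> coprime m W}"
    proof
      fix m assume "m \<in> f ` {..<T}"
      then obtain t where t: "t < T" "m = f t" by auto
      have "f t \<le> W * Suc t" using assms by (simp add: f_def)
      also have "\<dots> \<le> W * T" using t by (intro mult_left_mono) auto
      also have "\<dots> \<le> Y" by (simp add: T_def)
      finally have "f t \<le> Y" .
      moreover have "coprime (f t) W"
        by (simp add: f_def coprime_iff_gcd_eq_1 gcd.commute)
           (metis add.commute gcd_add_mult gcd.commute gcd_1_nat mult.commute One_nat_def plus_1_eq_Suc)
      ultimately show "m \<in> {m. 1 \<le> m \<and> m \<le> Y \<and> coprime m W}"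
        using t by (auto simp: f_def)
    qed
  qed auto
  finally show ?thesis .
qed

text \<open>The factors \<open>d I\<close> range over integers up to \<open>Y\<close> coprime to
  \<open>W\<close>. The factorial \<open>W\<close> excludes exactly the primes up to
  \<open>2 * M ^ 2\<close>, as \<open>sum_pairwise_coprime_ge\<close> demands, and
  \<open>Y ^ M \<le> N\<close> keeps the entries in range.\<close>

lemma lcm_recip_sum_lower:
  fixes A :: "'a set"
  assumes "finite A" "A \<noteq> {}" "Y ^ (2 ^ card A - 1) \<le> N"
  defines "M \<equiv> 2 ^ card A - (1::nat)"
  defines "W \<equiv> fact (2 * M ^ 2) :: nat"
  assumes "Y \<ge> W"
  shows "(\<Sum>n\<in>A \<rightarrow>\<^sub>E {1..N}. 1 / real (LCM i\<in>A. n i)) \<ge> (ln (real (Y + 1) / real W) / real W) ^ M / 2"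
proof -
  define P where "P = Pow A - {{}}"
  have P: "finite P" "P \<noteq> {}" and cP: "card P = M"
    using assms by (auto simp: P_def M_def card_Pow)
  have "W > 0" by (simp add: W_def)
  define D where "D = {m. 1 \<le> m \<and> m \<le> Y \<and> coprime m W}"
  have "finite D" by (rule finite_subset[of _ "{..Y}"]) (auto simp: D_def)
  define G where "G = {d. d \<in> P \<rightarrow>\<^sub>E D \<and> pairwise (\<lambda>i j. coprime (d i) (d j)) P}"
  have finG: "finite G"
    by (rule finite_subset[of _ "P \<rightarrow>\<^sub>E D"]) (auto simp: G_def intro!: finite_PiE P \<open>finite D\<close>)
  have inj: "inj_on (subset_prod A) G"
    using inj_on_subset_prod[OF assms(1), of D] by (simp add: G_def P_def)
  have sub: "subset_prod A ` G \<subseteq> A \<rightarrow>\<^sub>E {1..N}"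
  proof (rule image_subsetI)
    fix d assume "d \<in> G"
    then have d: "d \<in> P \<rightarrow>\<^sub>E D" by (simp add: G_def)
    have "(\<Prod>I | I \<subseteq> A \<and> i \<in> I. d I) \<in> {1..N}" if "i \<in> A" for i
    proof -
      define X where "X = {I. I \<subseteq> A \<and> i \<in> I}"
      have X: "X \<subseteq> P" by (auto simp: X_def P_def)
      have "d I \<in> D" if "I \<in> X" for I using d X that by auto
      then have *: "1 \<le> d I" "d I \<le> Y" if "I \<in> X" for I using that by (auto simp: D_def)
      \<comment> \<open>At most \<open>M\<close> nonempty sets contain \<open>i\<close>, so each
        entry is at most \<open>Y ^ M\<close>.\<close>
      have "(\<Prod>I\<in>X. d I) \<le> (\<Prod>I\<in>X. Y)" using * by (intro prod_mono) auto
      also have "\<dots> = Y ^ card X" by simp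
      also have "\<dots> \<le> Y ^ M" using \<open>Y \<ge> W\<close> \<open>W > 0\<close> card_mono[OF P(1) X]
        by (intro power_increasing) (auto simp: cP)
      also have "\<dots> \<le> N" using assms(3) by (simp add: M_def)
      finally have "(\<Prod>I\<in>X. d I) \<le> N" .
      moreover have "(\<Prod>I\<in>X. d I) \<ge> 1" using * by (intro prod_ge_1) auto
      ultimately show ?thesis by (simp add: X_def)
    qed
    then show "subset_prod A d \<in> A \<rightarrow>\<^sub>E {1..N}" by (auto simp: subset_prod_def)
  qed
  \<comment> \<open>Nonnegativity is what permits raising the lower bound to the power
    \<open>M\<close>.\<close>
  have "ln (real (Y + 1) / real W) \<ge> 0"
    using \<open>Y \<ge> W\<close> \<open>W > 0\<close> by (intro ln_ge_zero) (simp add: field_simps)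
  then have "(ln (real (Y + 1) / real W) / real W) ^ M / 2 \<le> (\<Sum>m\<in>D. inverse (real m)) ^ card P / 2"
    unfolding cP D_def using sum_inverse_coprime_ge[OF \<open>W > 0\<close>, of Y]
    by (intro divide_right_mono power_mono) auto
  also have "\<dots> \<le> (\<Sum>d\<in>G. \<Prod>I\<in>P. inverse (real (d I)))"
    unfolding G_def
  proof (rule sum_pairwise_coprime_ge[OF \<open>finite D\<close> P])
    fix m n :: nat assume "m dvd n" "n \<in> D"
    then show "m \<in> D" by (auto simp: D_def intro!: Suc_leI Nat.gr0I dest: dvd_imp_le coprime_divisors[of _ _ W W])
  next
    fix p :: nat assume "prime p" "p \<in> D"
    then have "\<not> p dvd W"
      by (auto simp: D_def dest: coprime_common_divisor not_prime_unit)
    then show "p > 2 * card P ^ 2" using \<open>prime p\<close> prime_gt_0_nat[of p] by (simp add: W_def cP prime_dvd_fact_iff)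
  qed
  also have "\<dots> \<le> (\<Sum>d\<in>G. 1 / real (LCM i\<in>A. subset_prod A d i))"
  proof (rule sum_mono)
    fix d assume "d \<in> G"
    then have "d \<in> P \<rightarrow>\<^sub>E D" by (simp add: G_def)
    then have "d I \<ge> 1" if "I \<in> P" for I using that by (auto simp: D_def dest!: PiE_mem)
    then have pos: "(\<Prod>I\<in>P. d I) > 0" by (intro prod_pos) force
    have "(LCM i\<in>A. subset_prod A d i) dvd (\<Prod>I\<in>P. d I)"
    proof (rule Lcm_least)
      fix b assume "b \<in> subset_prod A d ` A"
      then obtain i where "i \<in> A" "b = (\<Prod>I | I \<subseteq> A \<and> i \<in> I. d I)" by (auto simp: subset_prod_def)
      moreover have "(\<Prod>I | I \<subseteq> A \<and> i \<in> I. d I) dvd (\<Prod>I\<in>P. d I)"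
        by (intro prod_dvd_prod_subset P) (auto simp: P_def)
      ultimately show "b dvd (\<Prod>I\<in>P. d I)" by simp
    qed
    with pos have "(LCM i\<in>A. subset_prod A d i) \<le> (\<Prod>I\<in>P. d I)" "(LCM i\<in>A. subset_prod A d i) > 0"
      by (auto dest: dvd_imp_le intro!: Nat.gr0I)
    then have "inverse (real (\<Prod>I\<in>P. d I)) \<le> inverse (real (LCM i\<in>A. subset_prod A d i))"
      by (intro le_imp_inverse_le) (simp_all only: of_nat_le_iff of_nat_0_less_iff)
    then show "(\<Prod>I\<in>P. inverse (real (d I))) \<le> 1 / real (LCM i\<in>A. subset_prod A d i)"
      by (simp add: prod_inversef[symmetric] divide_inverse o_def)
  qed
  also have "\<dots> = (\<Sum>n\<in>subset_prod A ` G. 1 / real (LCM i\<in>A. n i))"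
    using sum.reindex[OF inj, of "\<lambda>n. 1 / real (LCM i\<in>A. n i)"] by simp
  also have "\<dots> \<le> (\<Sum>n\<in>A \<rightarrow>\<^sub>E {1..N}. 1 / real (LCM i\<in>A. n i))"
    using sub assms(1) by (intro sum_mono2 finite_PiE) auto
  finally show ?thesis .
qed

theorem theorem3:
  fixes k :: nat
  assumes "k \<ge> 3"
  shows "\<exists>c1 c2 :: real. c1 > 0 \<and> c2 > 0 \<and>
    (\<forall>\<^sub>F x :: real in at_top.
       c1 * ln x ^ (2 ^ k - 1) \<le> lcm_recip_sum k x \<and>
       lcm_recip_sum k x \<le> c2 * ln x ^ (2 ^ k - 1))"
proof -
  define M :: nat where "M = 2 ^ k - 1"
  define W :: nat where "W = fact (2 * M ^ 2)"
  have "(2::nat) ^ 1 \<le> 2 ^ k" using assms by (intro power_increasing) auto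
  then have "M > 0" by (simp add: M_def)
  have "W > 0" by (simp add: W_def)
  \<comment> \<open>The base collects \<open>ln y = ln x / M\<close> for
    \<open>y = root M x\<close>, a factor 1/2 lost on removing \<open>ln W\<close>, and the density
    \<open>1 / W\<close>; the outer 1/2 pays for coprimality.\<close>
  define c1 where "c1 = (1 / (2 * real M * real W)) ^ M / 2"
  have S: "lcm_recip_sum k x = (\<Sum>n\<in>{1..k} \<rightarrow>\<^sub>E {1..nat \<lfloor>x\<rfloor>}. 1 / real (LCM i\<in>{1..k}. n i))"
    if "x \<ge> 1" for x
  proof -
    have "{m::nat. 1 \<le> m \<and> real m \<le> x} = {1..nat \<lfloor>x\<rfloor>}"
      using that by (auto simp: le_nat_floor le_nat_iff le_floor_iff)
    then show ?thesis by (simp add: lcm_recip_sum_def)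
  qed
  \<comment> \<open>From \<open>exp 1\<close> on, \<open>ln x \<ge> 1\<close> absorbs the constant
    in \<open>harm N \<le> 1 + ln N\<close>.\<close>
  have upper: "lcm_recip_sum k x \<le> 2 ^ M * ln x ^ M" if "x \<ge> exp 1" for x
  proof -
    have "x \<ge> 1" using that exp_ge_add_one_self[of 1] by linarith
    have "ln x \<ge> 1" using that \<open>x \<ge> 1\<close> by (subst ln_ge_iff) auto
    define N where "N = nat \<lfloor>x\<rfloor>"
    have N: "N \<ge> 1" "real N \<le> x" using \<open>x \<ge> 1\<close> by (auto simp: N_def le_nat_iff le_floor_iff)
    \<comment> \<open>The sequence \<open>harm n - ln n\<close> decreases from its value 1 at
      \<open>n = 1\<close>.\<close>
    have "harm N \<le> 1 + ln (real N)"
      using euler_mascheroni_sequence_decreasing[of 1 N] N by (simp add: harm_def)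
    also have "ln (real N) \<le> ln x" using N by (subst ln_le_cancel_iff) auto
    finally have "harm N \<le> 2 * ln x" using \<open>ln x \<ge> 1\<close> by simp
    then have "harm N ^ M \<le> (2 * ln x) ^ M" by (intro power_mono harm_nonneg)
    with lcm_recip_sum_upper[of "{1..k}" N] show ?thesis
      using S[OF \<open>x \<ge> 1\<close>] by (simp add: N_def M_def power_mult_distrib)
  qed
  \<comment> \<open>The threshold gives \<open>root M x \<ge> W ^ 2\<close>, hence
    \<open>ln W\<close> is at most half of \<open>ln y\<close>, and also
    \<open>Y \<ge> W\<close>.\<close>
  have lower: "c1 * ln x ^ M \<le> lcm_recip_sum k x" if x: "x \<ge> real W ^ (2 * M)" for x
  proof -
    have W1: "real W \<ge> 1" using \<open>W > 0\<close> by simp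
    then have "x \<ge> 1" using x one_le_power[of "real W" "2 * M"] by linarith
    define y where "y = root M x"
    have y: "y ^ M = x" "y \<ge> 0" using \<open>M > 0\<close> \<open>x \<ge> 1\<close> by (simp_all add: y_def)
    define Y where "Y = nat \<lfloor>y\<rfloor>"
    have Y: "real Y \<le> y" "y \<le> real (Y + 1)" using y by (auto simp: Y_def) linarith+
    have "(real W ^ 2) ^ M \<le> y ^ M" using x y by (simp add: power_mult)
    then have Wy: "real W ^ 2 \<le> y" using power_mono_iff[of "real W ^ 2" y M] y \<open>M > 0\<close> by simp
    have "real W \<le> real W ^ 2" using W1 by (simp add: power2_eq_square)
    then have "y \<ge> real W" using Wy by linarith
    then have "Y \<ge> W" by (simp add: Y_def le_nat_floor)
    have "real (Y ^ M) \<le> x" using Y power_mono[of "real Y" y M] by (simp add: y)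
    then have YN: "Y ^ M \<le> nat \<lfloor>x\<rfloor>" by (rule le_nat_floor)
    have "y > 0" using \<open>y \<ge> real W\<close> W1 by linarith
    have lnx: "ln x = real M * ln y" using y \<open>y > 0\<close> by (metis ln_realpow)
    have "ln (real W ^ 2) \<le> ln y" using Wy W1 \<open>y > 0\<close> by (subst ln_le_cancel_iff) auto
    then have "2 * ln (real W) \<le> ln y" using W1 by (simp add: ln_realpow)
    moreover have "ln (y / real W) \<le> ln (real (Y + 1) / real W)"
      using Y W1 \<open>y > 0\<close> by (subst ln_le_cancel_iff) (auto simp: divide_right_mono)
    moreover have "ln (y / real W) = ln y - ln (real W)" using \<open>y > 0\<close> W1 by (simp add: ln_div)
    ultimately have "ln y / 2 \<le> ln (real (Y + 1) / real W)" by linarith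
    then have "ln y / 2 / real W \<le> ln (real (Y + 1) / real W) / real W"
      by (rule divide_right_mono) simp
    moreover have "ln y / 2 / real W = ln x / (2 * real M * real W)"
      using lnx \<open>M > 0\<close> by simp
    ultimately have "(ln x / (2 * real M * real W)) ^ M \<le> (ln (real (Y + 1) / real W) / real W) ^ M"
      using \<open>x \<ge> 1\<close> by (intro power_mono) auto
    moreover have "c1 * ln x ^ M = (ln x / (2 * real M * real W)) ^ M / 2"
      by (simp add: c1_def power_divide)
    ultimately have "c1 * ln x ^ M \<le> (ln (real (Y + 1) / real W) / real W) ^ M / 2" by simp
    also have "\<dots> \<le> lcm_recip_sum k x"
      using lcm_recip_sum_lower[of "{1..k}" Y "nat \<lfloor>x\<rfloor>"] YN \<open>Y \<ge> W\<close> assms S[OF \<open>x \<ge> 1\<close>]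
      by (simp add: M_def W_def)
    finally show ?thesis .
  qed
  have "c1 > 0" using \<open>M > 0\<close> \<open>W > 0\<close> by (simp add: c1_def)
  moreover have "\<forall>\<^sub>F x in at_top. c1 * ln x ^ M \<le> lcm_recip_sum k x \<and> lcm_recip_sum k x \<le> 2 ^ M * ln x ^ M"
    using eventually_ge_at_top[of "exp 1"] eventually_ge_at_top[of "real W ^ (2 * M)"]
    by eventually_elim (auto intro: upper lower)
  ultimately show ?thesis unfolding M_def by (intro exI[of _ c1] exI[of _ "2 ^ (2 ^ k - 1)"]) auto
qed

end
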